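(* Let $(X,* )$ be a finite quandle with exactly two orbits $X_1$ and $X_2$. Then any right continuous poset $(X,<)$ on $X$ is bipartite with vertex sets $X_1$ and $X_2$; that is, no two elements of $X_1$ are related by $<$ and no two elements of $X_2$ are related by $<$.
   Context: A quandle is a set $X$ with a binary operation $*$ such that: (1) $x*x=x$ for all $x$; (2) for all $y,z\in X$ there is a unique $x\in X$ with $x*y=z$; (3) $(x*y)*z=(x*z)*(y*z)$ for all $x,y,z$. The right multiplications $R_y:X\to X$, $R_y(x)=x*y$, are automorphisms of $X$; the subgroup of the automorphism group they generate is the inner automorphism group $\mathrm{Inn}(X)$, and the orbits of $X$ are the orbits of its action on $X$. A right continuous poset on $X$ is a partial order $\leq$ on $X$, with strict part $<$, such that $x<y$ implies $x*z<y*z$ for all $x,y,z\in X$. A poset is viewed as a directed graph with an edge from $x$ to $y$ whenever $x<y$. *)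

theory Defs
  imports "HOL-Algebra.Group_Action" "HOL-Algebra.Generated_Groups"
begin

locale quandle =
  fixes X :: "'a set" and q :: "'a \<Rightarrow> 'a \<Rightarrow> 'a" (infixl "\<star>" 70)
  assumes closed: "\<lbrakk>x \<in> X; y \<in> X\<rbrakk> \<Longrightarrow> x \<star> y \<in> X"
    and idem: "x \<in> X \<Longrightarrow> x \<star> x = x"
    and right_div: "\<lbrakk>y \<in> X; z \<in> X\<rbrakk> \<Longrightarrow> \<exists>!x. x \<in> X \<and> x \<star> y = z"
    and distrib: "\<lbrakk>x \<in> X; y \<in> X; z \<in> X\<rbrakk> \<Longrightarrow> (x \<star> y) \<star> z = (x \<star> z) \<star> (y \<star> z)"

text \<open>Self-maps of the carrier are extensional, as required by \<^const>\<open>Bij\<close> and \<^const>\<open>BijGroup\<close>.\<close>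

definition right_mult :: "'a set \<Rightarrow> ('a \<Rightarrow> 'a \<Rightarrow> 'a) \<Rightarrow> 'a \<Rightarrow> 'a \<Rightarrow> 'a"
  where "right_mult X q y = (\<lambda>x\<in>X. q x y)"

definition quandle_auts :: "'a set \<Rightarrow> ('a \<Rightarrow> 'a \<Rightarrow> 'a) \<Rightarrow> ('a \<Rightarrow> 'a) set"
  where "quandle_auts X q = {f \<in> Bij X. \<forall>x\<in>X. \<forall>y\<in>X. f (q x y) = q (f x) (f y)}"

definition Aut_group :: "'a set \<Rightarrow> ('a \<Rightarrow> 'a \<Rightarrow> 'a) \<Rightarrow> ('a \<Rightarrow> 'a) monoid"
  where "Aut_group X q = BijGroup X \<lparr>carrier := quandle_auts X q\<rparr>"

definition Inn_group :: "'a set \<Rightarrow> ('a \<Rightarrow> 'a \<Rightarrow> 'a) \<Rightarrow> ('a \<Rightarrow> 'a) monoid"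
  where "Inn_group X q =
    Aut_group X q \<lparr>carrier := generate (Aut_group X q) (right_mult X q ` X)\<rparr>"

definition quandle_orbits :: "'a set \<Rightarrow> ('a \<Rightarrow> 'a \<Rightarrow> 'a) \<Rightarrow> 'a set set"
  where "quandle_orbits X q = orbits (Inn_group X q) X (\<lambda>f. f)"

text \<open>A poset is given by its non-strict order \<^term>\<open>r\<close>; its strict part, which is also the
  edge set of the associated directed graph, is \<^term>\<open>r - Id\<close>.\<close>

definition right_continuous_poset :: "'a set \<Rightarrow> ('a \<Rightarrow> 'a \<Rightarrow> 'a) \<Rightarrow> 'a rel \<Rightarrow> bool"
  where "right_continuous_poset X q r \<longleftrightarrow> partial_order_on X r \<and>
    (\<forall>x\<in>X. \<forall>y\<in>X. \<forall>z\<in>X. (x, y) \<in> r - Id \<longrightarrow> (q x z, q y z) \<in> r - Id)"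

definition bipartite_digraph :: "'a set \<Rightarrow> 'a rel \<Rightarrow> 'a set \<Rightarrow> 'a set \<Rightarrow> bool"
  where "bipartite_digraph V E A B \<longleftrightarrow> E \<subseteq> V \<times> V \<and> A \<union> B = V \<and> A \<inter> B = {} \<and>
    (\<forall>x\<in>A. \<forall>y\<in>A. (x, y) \<notin> E) \<and> (\<forall>x\<in>B. \<forall>y\<in>B. (x, y) \<notin> E)"

context quandle
begin

lemma subgroup_quandle_auts: "subgroup (quandle_auts X q) (BijGroup X)"
proof (rule subgroup.intro)
  show "quandle_auts X q \<subseteq> carrier (BijGroup X)"
    by (auto simp: quandle_auts_def BijGroup_def)
next
  fix f g assume "f \<in> quandle_auts X q" "g \<in> quandle_auts X q"
  moreover from this have "g \<in> X \<rightarrow> X"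
    by (auto simp: quandle_auts_def dest: Bij_imp_funcset)
  ultimately show "f \<otimes>\<^bsub>BijGroup X\<^esub> g \<in> quandle_auts X q"
    using closed by (auto simp: quandle_auts_def BijGroup_def compose_Bij compose_eq Pi_iff)
next
  show "\<one>\<^bsub>BijGroup X\<^esub> \<in> quandle_auts X q"
    by (auto simp: quandle_auts_def BijGroup_def id_Bij closed)
next
  fix f assume "f \<in> quandle_auts X q"
  then have f: "f \<in> Bij X" "\<And>x y. \<lbrakk>x \<in> X; y \<in> X\<rbrakk> \<Longrightarrow> f (x \<star> y) = f x \<star> f y"
    by (auto simp: quandle_auts_def)
  have "inv_into X f (x \<star> y) = inv_into X f x \<star> inv_into X f y" if "x \<in> X" "y \<in> X" for x y
    by (rule Bij_inv_into_lemma) (use f that closed in auto)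
  with f show "inv\<^bsub>BijGroup X\<^esub> f \<in> quandle_auts X q"
    by (auto simp: quandle_auts_def inv_BijGroup restrict_inv_into_Bij closed)
qed

lemma group_Aut_group: "group (Aut_group X q)"
  unfolding Aut_group_def
  by (rule subgroup.subgroup_is_group[OF subgroup_quandle_auts group_BijGroup])

lemma right_mult_in_quandle_auts:
  assumes "y \<in> X"
  shows "right_mult X q y \<in> quandle_auts X q"
proof -
  have "bij_betw (\<lambda>x. x \<star> y) X X"
  proof (intro bij_betwI')
    fix x z assume xz: "x \<in> X" "z \<in> X"
    show "(x \<star> y = z \<star> y) = (x = z)"
      using right_div[OF assms closed[OF xz(1) assms]] xz by metis
  next
    fix z assume "z \<in> X"
    then show "\<exists>x\<in>X. z = x \<star> y"
      using right_div[OF assms, of z] by metis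
  qed (use assms closed in simp)
  then have "right_mult X q y \<in> Bij X"
    by (auto simp: right_mult_def Bij_def)
  then show ?thesis
    using distrib[OF _ _ assms] by (simp add: quandle_auts_def right_mult_def closed)
qed

lemma subgroup_Inn: "subgroup (carrier (Inn_group X q)) (Aut_group X q)"
proof -
  have "right_mult X q ` X \<subseteq> carrier (Aut_group X q)"
    using right_mult_in_quandle_auts by (simp add: Aut_group_def image_subset_iff)
  then show ?thesis
    using group.generate_is_subgroup[OF group_Aut_group] by (simp add: Inn_group_def)
qed

lemma group_action_Inn: "group_action (Inn_group X q) X (\<lambda>f. f)"
proof -
  have "subgroup (carrier (Inn_group X q)) (BijGroup X)"
    using group.incl_subgroup[OF group_BijGroup subgroup_quandle_auts] subgroup_Inn
    by (simp add: Aut_group_def)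
  then have "group_hom (BijGroup X \<lparr>carrier := carrier (Inn_group X q)\<rparr>) (BijGroup X) (\<lambda>f. f)"
    using group.canonical_inj_is_hom[OF group_BijGroup] by (simp add: id_def)
  then show ?thesis
    by (simp add: group_action_def Inn_group_def Aut_group_def)
qed

end

end

theory Submission
  imports Defs
begin

text \<open>In a finite poset every order-preserving permutation preserves the size of strict down-sets.
  The right multiplications are such permutations, so this size is constant on each orbit, whereas
  it strictly increases along the strict order.\<close>

definition height :: "'a rel \<Rightarrow> 'a \<Rightarrow> nat"
  where "height r x = card {z. (z, x) \<in> r - Id}"

text \<open>The order is a relation on \<open>X\<close>, so every strict down-set lies in
  \<open>X\<close>. Finiteness matters because \<open>card\<close> sends infinite sets to 0.\<close>

lemma finite_strict_below:
  assumes "finite X" "partial_order_on X r"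
  shows "finite {z. (z, x) \<in> r - Id}"
  by (rule finite_subset[OF _ assms(1)])
    (use assms(2) in \<open>auto simp: partial_order_on_def preorder_on_def\<close>)

lemma height_strict_mono:
  assumes "finite X" "partial_order_on X r" "(x, y) \<in> r - Id"
  shows "height r x < height r y"
proof -
  have trans: "trans r" and antisym: "antisym r"
    using assms(2) by (auto simp: partial_order_on_def preorder_on_def)
  \<comment> \<open>Antisymmetry excludes \<open>z = y\<close>, which would close a cycle with
    \<open>x\<close>. The inclusion obtained is proper because \<open>x\<close> lies strictly below
    \<open>y\<close> but not strictly below itself.\<close>
  have "(z, y) \<in> r - Id" if "(z, x) \<in> r - Id" for z
    using that assms(3) transD[OF trans, of z x y] antisymD[OF antisym, of x y] by auto
  then have "{z. (z, x) \<in> r - Id} \<subset> {z. (z, y) \<in> r - Id}"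
    using assms(3) by blast
  then show ?thesis
    unfolding height_def
    by (rule psubset_card_mono[OF finite_strict_below[OF assms(1,2)]])
qed

text \<open>Nothing is assumed about the inverse of \<open>f\<close>, so injectivity on down-sets
  yields only one inequality. Equality follows by summing over the finite set \<open>X\<close>,
  which \<open>f\<close> permutes.\<close>

lemma height_order_preserving_Bij:
  assumes "finite X" "partial_order_on X r" "f \<in> Bij X"
    and mono: "\<And>x y. \<lbrakk>x \<in> X; y \<in> X; (x, y) \<in> r - Id\<rbrakk> \<Longrightarrow> (f x, f y) \<in> r - Id"
    and "x \<in> X"
  shows "height r (f x) = height r x"
proof -
  have bij: "bij_betw f X X"
    using assms(3) by (simp add: Bij_def)
  have sub: "r \<subseteq> X \<times> X"
    using assms(2) by (auto simp: partial_order_on_def preorder_on_def)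
  have le: "height r y \<le> height r (f y)" if "y \<in> X" for y
    unfolding height_def
  proof (rule card_inj_on_le)
    show "inj_on f {z. (z, y) \<in> r - Id}"
      by (rule inj_on_subset[OF bij_betw_imp_inj_on[OF bij]]) (use sub in blast)
    show "f ` {z. (z, y) \<in> r - Id} \<subseteq> {z. (z, f y) \<in> r - Id}"
    proof (rule image_subsetI)
      fix z assume z: "z \<in> {z. (z, y) \<in> r - Id}"
      then have "z \<in> X"
        using sub by auto
      with mono[of z y] that z show "f z \<in> {z. (z, f y) \<in> r - Id}"
        by simp
    qed
  qed (rule finite_strict_below[OF assms(1,2)])
  have "(\<Sum>y\<in>X. height r y) = (\<Sum>y\<in>X. height r (f y))"
    by (rule sum.reindex_bij_betw[OF bij, symmetric])
  \<comment> \<open>Termwise inequalities between equal finite sums are all equalities.\<close>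
  from sum_mono_inv[OF this le \<open>x \<in> X\<close> assms(1)] show ?thesis
    by (rule sym)
qed

text \<open>Right continuity makes each generator order preserving; invariance of
  \<open>height\<close> then passes to inverses and products by induction on the generated
  subgroup.\<close>

lemma (in quandle) height_Inn:
  assumes "finite X" "right_continuous_poset X q r" "f \<in> carrier (Inn_group X q)" "x \<in> X"
  shows "height r (f x) = height r x"
proof -
  interpret A: group "Aut_group X q"
    by (rule group_Aut_group)
  have gens: "right_mult X q ` X \<subseteq> carrier (Aut_group X q)"
    using right_mult_in_quandle_auts by (auto simp: Aut_group_def)
  have maps: "g y \<in> X" if "g \<in> carrier (Aut_group X q)" "y \<in> X" for g y
    using that by (auto simp: Aut_group_def quandle_auts_def dest: Bij_imp_funcset)
  \<comment> \<open>Products in \<open>BijGroup\<close> are extensional compositions, so they can be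
    evaluated pointwise only on \<open>X\<close>.\<close>
  have mult: "(g \<otimes>\<^bsub>Aut_group X q\<^esub> h) y = g (h y)"
    if "g \<in> carrier (Aut_group X q)" "h \<in> carrier (Aut_group X q)" "y \<in> X" for g h y
    using that by (auto simp: Aut_group_def quandle_auts_def BijGroup_def compose_eq)
  have one_apply: "\<one>\<^bsub>Aut_group X q\<^esub> y = y" if "y \<in> X" for y
    using that by (simp add: Aut_group_def BijGroup_def)
  have base: "height r (right_mult X q z y) = height r y" if "z \<in> X" "y \<in> X" for y z
  proof (rule height_order_preserving_Bij[OF \<open>finite X\<close> _ _ _ \<open>y \<in> X\<close>])
    show "right_mult X q z \<in> Bij X"
      using right_mult_in_quandle_auts[OF \<open>z \<in> X\<close>] by (simp add: quandle_auts_def)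
  qed (use assms(2) \<open>z \<in> X\<close> in \<open>auto simp: right_continuous_poset_def right_mult_def\<close>)
  have "f \<in> generate (Aut_group X q) (right_mult X q ` X)"
    using assms(3) by (simp add: Inn_group_def)
  then show ?thesis
    using \<open>x \<in> X\<close>
  proof (induction arbitrary: x rule: generate.induct)
    case one
    then show ?case by (simp add: one_apply)
  next
    case (incl h)
    then show ?case using base by auto
  next
    case (inv h)
    then have h: "h \<in> carrier (Aut_group X q)"
      using gens by auto
    \<comment> \<open>Monotonicity of the inverse is avoided: invariance under the generator
      \<open>h\<close> is applied at the preimage of \<open>x\<close>.\<close>
    have "h ((inv\<^bsub>Aut_group X q\<^esub> h) x) = x"
      using mult[of h "inv\<^bsub>Aut_group X q\<^esub> h" x] h inv.prems by (simp add: one_apply)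
    moreover have "height r (h ((inv\<^bsub>Aut_group X q\<^esub> h) x)) = height r ((inv\<^bsub>Aut_group X q\<^esub> h) x)"
      using base inv.hyps maps[OF A.inv_closed[OF h] inv.prems] by auto
    ultimately show ?case by simp
  next
    case (eng g h)
    then have "g \<in> carrier (Aut_group X q)" "h \<in> carrier (Aut_group X q)"
      using A.generate_in_carrier[OF gens] by auto
    with eng show ?case by (simp add: mult maps)
  qed
qed

lemma (in quandle) orbit_antichain:
  assumes "finite X" "right_continuous_poset X q r" "Y \<in> quandle_orbits X q" "x \<in> Y" "y \<in> Y"
  shows "(x, y) \<notin> r - Id"
proof
  assume "(x, y) \<in> r - Id"
  then have "height r x < height r y"
    using height_strict_mono[OF assms(1)] assms(2) by (simp only: right_continuous_poset_def)
  \<comment> \<open>Both \<open>x\<close> and \<open>y\<close> are images of a common base point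
    \<open>w\<close>, hence have its height.\<close>
  moreover obtain w where "w \<in> X" "Y = orbit (Inn_group X q) (\<lambda>f. f) w"
    using assms(3) by (auto simp: quandle_orbits_def orbits_def)
  then have "height r x = height r w" "height r y = height r w"
    using height_Inn[OF assms(1,2)] assms(4,5) by (auto simp: orbit_def)
  ultimately show False by simp
qed

theorem proposition4p7:
  fixes X X1 X2 :: "'a set" and q :: "'a \<Rightarrow> 'a \<Rightarrow> 'a" and r :: "'a rel"
  assumes "quandle X q"
    and "finite X"
    and "quandle_orbits X q = {X1, X2}" and "X1 \<noteq> X2"
    and "right_continuous_poset X q r"
  shows "bipartite_digraph X (r - Id) X1 X2"
proof -
  interpret quandle X q by fact
  interpret group_action "Inn_group X q" X "\<lambda>f. f"
    by (rule group_action_Inn)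
  \<comment> \<open>The orbits of a group action partition \<open>X\<close>, and here there are just
    these two distinct ones.\<close>
  have "X1 \<union> X2 = X"
    using orbits_coverture assms(3) by (simp add: quandle_orbits_def)
  moreover have "X1 \<inter> X2 = {}"
    using disjoint_union[of X1 X2] assms(3,4) by (auto simp: quandle_orbits_def)
  moreover have "r \<subseteq> X \<times> X"
    using assms(5) by (auto simp: right_continuous_poset_def partial_order_on_def preorder_on_def)
  moreover have "(x, y) \<notin> r - Id" if "x \<in> Y" "y \<in> Y" "Y \<in> {X1, X2}" for x y Y
    using orbit_antichain[OF assms(2,5)] assms(3) that by simp
  ultimately show ?thesis
    unfolding bipartite_digraph_def by (intro conjI ballI) auto
qed

end
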